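(* Let $n\ge 2$ be an integer, let $\omega=e^{2\pi i/n}$, and let $f:\mathbb{C}\to\mathbb{C}$ be an exponential function, i.e. $f(x+y)=f(x)f(y)$ for all $x,y\in\mathbb{C}$. Let $F$ be the circulant matrix function corresponding to $f$. Then, for every $m\in\{0,1,\dots,n-1\}$ and all $x,y\in\mathbb{C}$, $$F(x+\omega^m y)=\Omega^{-m}F(y)\,\Omega^{m}F(x).$$
   Context: Matrix indices run over $0,\dots,n-1$. $\Omega=\mathrm{diag}[1,\omega,\omega^2,\dots,\omega^{n-1}]$. For complex numbers $a_0,\dots,a_{n-1}$, $\mathrm{circ}(a_0,a_1,\dots,a_{n-1})$ denotes the $n\times n$ circulant matrix with first row $(a_0,\dots,a_{n-1})$ whose $(j,k)$ entry is $a_{(k-j)\bmod n}$. A function $h:\mathbb{C}\to\mathbb{C}$ is of type $j$ ($j\in\{0,\dots,n-1\}$) if $h(\omega x)=\omega^j h(x)$ for all $x\in\mathbb{C}$. Every $f:\mathbb{C}\to\mathbb{C}$ can be written uniquely as $f=\sum_{j=0}^{n-1}f_j$ with $f_j$ of type $j$; the $f_j$ are called the components of $f$, and explicitly $f_j(x)=\frac1n\sum_{k=0}^{n-1}\omega^{-jk}f(\omega^k x)$. The circulant matrix function corresponding to $f$ is $F(x)=\mathrm{circ}(f_0(x),f_1(x),\dots,f_{n-1}(x))$. No continuity of $f$ is assumed. *)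

theory Defs
  imports Complex_Main "Jordan_Normal_Form.Gauss_Jordan_Elimination"
begin

definition omega :: "nat \<Rightarrow> complex" where
  "omega n = exp (2 * of_real pi * \<i> / of_nat n)"

definition Omega :: "nat \<Rightarrow> complex mat" where
  "Omega n = mat_diag n (\<lambda>j. omega n ^ j)"

text \<open>Integer powers of an invertible square matrix. A negative power of a singular matrix is
  unspecified; \<^term>\<open>Omega n\<close> is invertible, see \<open>Omega_inverse\<close> below.\<close>

definition mat_powi :: "'a::field mat \<Rightarrow> int \<Rightarrow> 'a mat" where
  "mat_powi A k =
     (if k \<ge> 0 then A ^\<^sub>m nat k else the (mat_inverse A) ^\<^sub>m nat (- k))"

definition circ :: "nat \<Rightarrow> (nat \<Rightarrow> complex) \<Rightarrow> complex mat" where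
  "circ n a = mat n n (\<lambda>(j, k). a (nat ((int k - int j) mod int n)))"

definition of_type :: "nat \<Rightarrow> nat \<Rightarrow> (complex \<Rightarrow> complex) \<Rightarrow> bool" where
  "of_type n j h \<longleftrightarrow> (\<forall>x. h (omega n * x) = omega n ^ j * h x)"

definition is_decomposition ::
  "nat \<Rightarrow> (complex \<Rightarrow> complex) \<Rightarrow> (nat \<Rightarrow> complex \<Rightarrow> complex) \<Rightarrow> bool" where
  "is_decomposition n f c \<longleftrightarrow>
     (\<forall>j<n. of_type n j (c j)) \<and> (\<forall>x. f x = (\<Sum>j<n. c j x))"

text \<open>The \<open>j\<close>-th component is meaningful for \<open>j < n\<close>. Existence and uniqueness of the
  decomposition, and the explicit formula, are proved below.\<close>

definition fcomponent :: "nat \<Rightarrow> (complex \<Rightarrow> complex) \<Rightarrow> nat \<Rightarrow> complex \<Rightarrow> complex" where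
  "fcomponent n f j = (THE g. \<exists>c. is_decomposition n f c \<and> g = c j)"

definition circ_fun :: "nat \<Rightarrow> (complex \<Rightarrow> complex) \<Rightarrow> complex \<Rightarrow> complex mat" where
  "circ_fun n f x = circ n (\<lambda>j. fcomponent n f j x)"

text \<open>No regularity is required; in particular the zero function is exponential.\<close>

definition exponential :: "(complex \<Rightarrow> complex) \<Rightarrow> bool" where
  "exponential f \<longleftrightarrow> (\<forall>x y. f (x + y) = f x * f y)"

lemma omega_nonzero [simp]: "omega n \<noteq> 0"
  by (simp add: omega_def)

lemma omega_cis: "omega n = cis (2 * pi / real n)"
  by (simp add: omega_def cis_conv_exp mult_ac)

lemma omega_pow: "omega n ^ k = cis (2 * pi * real k / real n)"
  by (simp add: omega_cis DeMoivre mult_ac)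

lemma omega_pow_n: "n > 0 \<Longrightarrow> omega n ^ n = 1"
  by (simp add: omega_pow)

lemma omega_pow_inj:
  assumes "i < n" "j < n" "omega n ^ i = omega n ^ j"
  shows "i = j"
proof -
  have "inj_on (\<lambda>k. cis (2 * pi * real k / real n)) {..<n}"
    using bij_betw_roots_unity[of n] assms(1) by (auto simp: bij_betw_def)
  thus ?thesis using assms by (auto simp: omega_pow inj_on_def)
qed

lemma omega_orthogonality:
  assumes "i < n" "j < n"
  shows "(\<Sum>k<n. (omega n ^ i / omega n ^ j) ^ k) = (if i = j then of_nat n else 0)"
proof (cases "i = j")
  case False
  define z where "z = omega n ^ i / omega n ^ j"
  have "z \<noteq> 1"
    using omega_pow_inj[OF assms] False by (auto simp: z_def)
  moreover have "z ^ n = 1"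
  proof -
    have "(omega n ^ l) ^ n = 1" for l
      using omega_pow_n[of n] assms by (metis gr_implies_not0 gr0I mult.commute power_mult power_one)
    thus ?thesis by (simp add: z_def power_divide)
  qed
  ultimately show ?thesis
    using False geometric_sum[of z n] by (simp add: z_def)
qed simp

definition explicit_component ::
  "nat \<Rightarrow> (complex \<Rightarrow> complex) \<Rightarrow> nat \<Rightarrow> complex \<Rightarrow> complex" where
  "explicit_component n f j x =
     1 / of_nat n * (\<Sum>k<n. omega n powi (- int (j * k)) * f (omega n ^ k * x))"

lemma omega_powi: "omega n powi (- int (j * k)) = (1 / omega n ^ j) ^ k"
  by (simp only: power_int_minus power_int_of_nat power_mult power_divide power_one inverse_eq_divide)

lemma of_type_pow:
  assumes "of_type n j h"
  shows "h (omega n ^ k * x) = (omega n ^ j) ^ k * h x"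
proof (induction k)
  case (Suc k)
  have "h (omega n ^ Suc k * x) = h (omega n * (omega n ^ k * x))" by (simp add: mult_ac)
  also have "\<dots> = omega n ^ j * h (omega n ^ k * x)"
    using assms unfolding of_type_def by blast
  finally show ?case using Suc by (simp add: mult_ac)
qed simp

lemma explicit_component_decomposition:
  assumes "n > 0"
  shows "is_decomposition n f (explicit_component n f)"
  unfolding is_decomposition_def
proof (intro conjI allI impI)
  fix j assume "j < n"
  show "of_type n j (explicit_component n f j)"
    unfolding of_type_def
  proof
    fix x
    define w where "w = omega n ^ j"
    define g where "g k = (1 / w) ^ k * f (omega n ^ k * x)" for k
    have w: "w \<noteq> 0" by (simp add: w_def)
    have wn: "w ^ n = 1"
      using omega_pow_n[OF assms] by (metis w_def mult.commute power_mult power_one)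
    have shift: "(1 / w) ^ k * f (omega n ^ k * (omega n * x)) = w * g (Suc k)" for k
      using w by (simp add: g_def field_simps)
    have "g n = g 0"
      using wn omega_pow_n[OF assms] by (simp add: g_def power_divide)
    moreover have "(\<Sum>k<n. g (Suc k)) + g 0 = (\<Sum>k<n. g k) + g n"
      using sum.lessThan_Suc_shift[of g n] sum.lessThan_Suc[of g n] by (simp add: add.commute)
    ultimately have "(\<Sum>k<n. g (Suc k)) = (\<Sum>k<n. g k)" by simp
    hence "(\<Sum>k<n. (1 / w) ^ k * f (omega n ^ k * (omega n * x))) = w * (\<Sum>k<n. g k)"
      by (simp only: shift flip: sum_distrib_left)
    thus "explicit_component n f j (omega n * x) = omega n ^ j * explicit_component n f j x"
      unfolding explicit_component_def omega_powi g_def w_def by simp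
  qed
next
  fix x
  have eq: "(\<Sum>j<n. (1 / omega n ^ j) ^ k) = (if k = 0 then of_nat n else 0)" if "k < n" for k
  proof -
    have "(\<Sum>j<n. (1 / omega n ^ j) ^ k) = (\<Sum>j<n. (omega n ^ 0 / omega n ^ k) ^ j)"
      by (intro sum.cong refl) (simp add: power_divide mult.commute flip: power_mult)
    thus ?thesis using omega_orthogonality[of 0 n k] that assms by auto
  qed
  have "(\<Sum>j<n. explicit_component n f j x)
      = 1 / of_nat n * (\<Sum>j<n. \<Sum>k<n. (1 / omega n ^ j) ^ k * f (omega n ^ k * x))"
    by (simp only: explicit_component_def omega_powi sum_distrib_left)
  also have "(\<Sum>j<n. \<Sum>k<n. (1 / omega n ^ j) ^ k * f (omega n ^ k * x))
      = (\<Sum>k<n. (\<Sum>j<n. (1 / omega n ^ j) ^ k) * f (omega n ^ k * x))"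
    by (subst sum.swap) (simp only: sum_distrib_right)
  also have "\<dots> = (\<Sum>k<n. if k = 0 then of_nat n * f x else 0)"
    by (intro sum.cong refl) (auto simp: eq)
  also have "\<dots> = of_nat n * f x" using assms by simp
  finally show "f x = (\<Sum>j<n. explicit_component n f j x)" using assms by simp
qed

lemma decomposition_unique:
  assumes "is_decomposition n f c" "j < n"
  shows "c j = explicit_component n f j"
proof
  fix x
  have t: "c i (omega n ^ k * x) = (omega n ^ i) ^ k * c i x" if "i < n" for i k
    using assms that by (intro of_type_pow) (auto simp: is_decomposition_def)
  have "(\<Sum>k<n. (1 / omega n ^ j) ^ k * f (omega n ^ k * x))
      = (\<Sum>k<n. \<Sum>i<n. (omega n ^ i / omega n ^ j) ^ k * c i x)"
  proof (intro sum.cong refl)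
    fix k
    have "f (omega n ^ k * x) = (\<Sum>i<n. (omega n ^ i) ^ k * c i x)"
      using assms t by (simp add: is_decomposition_def)
    thus "(1 / omega n ^ j) ^ k * f (omega n ^ k * x)
        = (\<Sum>i<n. (omega n ^ i / omega n ^ j) ^ k * c i x)"
      by (simp add: sum_distrib_left power_divide)
  qed
  also have "\<dots> = (\<Sum>i<n. (\<Sum>k<n. (omega n ^ i / omega n ^ j) ^ k) * c i x)"
    by (subst sum.swap) (simp only: sum_distrib_right)
  also have "\<dots> = (\<Sum>i<n. if i = j then of_nat n * c j x else 0)"
    by (intro sum.cong refl) (auto simp: omega_orthogonality assms(2))
  also have "\<dots> = of_nat n * c j x" using assms by simp
  finally show "c j x = explicit_component n f j x"
    using assms(2) by (simp add: explicit_component_def omega_powi del: of_nat_mult)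
qed

lemma fcomponent_explicit:
  assumes "j < n"
  shows "fcomponent n f j x =
    1 / of_nat n * (\<Sum>k<n. omega n powi (- int (j * k)) * f (omega n ^ k * x))"
proof -
  have "fcomponent n f j = explicit_component n f j"
    unfolding fcomponent_def
  proof (rule the_equality)
    have "is_decomposition n f (explicit_component n f)"
      using assms by (intro explicit_component_decomposition) simp
    thus "\<exists>c. is_decomposition n f c \<and> explicit_component n f j = c j" by blast
  next
    fix g assume "\<exists>c. is_decomposition n f c \<and> g = c j"
    thus "g = explicit_component n f j" using decomposition_unique[OF _ assms] by blast
  qed
  thus ?thesis by (simp add: explicit_component_def)
qed

lemma Omega_inverse: "mat_inverse (Omega n) = Some (mat_diag n (\<lambda>j. 1 / omega n ^ j))"
proof -
  let ?D = "mat_diag n (\<lambda>j. 1 / omega n ^ j)"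
  have O: "Omega n \<in> carrier_mat n n" and D: "?D \<in> carrier_mat n n"
    by (simp_all add: Omega_def)
  have inv: "?D * Omega n = 1\<^sub>m n" "Omega n * ?D = 1\<^sub>m n"
    by (simp_all add: Omega_def)
  hence "Omega n \<in> Units (ring_mat TYPE(complex) n ())"
    using O D by (auto simp: Units_def ring_mat_def)
  then obtain B where B: "mat_inverse (Omega n) = Some B"
    using mat_inverse(1)[OF O, where b = "()"] by blast
  from mat_inverse(2)[OF O B] have "Omega n * B = 1\<^sub>m n" "B \<in> carrier_mat n n" by auto
  hence "B = ?D * Omega n * B" using inv by simp
  also have "\<dots> = ?D"
    using \<open>Omega n * B = 1\<^sub>m n\<close> O D \<open>B \<in> carrier_mat n n\<close> by (simp add: assoc_mult_mat[OF D O] right_mult_one_mat[OF D])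
  finally show ?thesis using B by simp
qed

end

theory Submission
  imports Defs
begin

text \<open>Conjugation by \<open>\<Omega>\<^sup>m\<close> multiplies the \<open>(j,k)\<close> entry by \<open>\<omega>\<close> to the power
  \<open>m(k - j)\<close>. The component in that entry has type \<open>k - j\<close>, so this turns \<open>F(y)\<close> into
  \<open>F(\<omega>\<^sup>m y)\<close>, and it remains to see that \<open>F\<close> is itself exponential. This holds because the
  discrete Fourier transform diagonalises all \<open>F(x)\<close> simultaneously, with eigenvalues
  \<open>f(\<omega>\<^sup>s x)\<close>.\<close>

lemma mat_diag_pow: "mat_diag n d ^\<^sub>m k = mat_diag n (\<lambda>j. (d j :: 'a :: comm_semiring_1) ^ k)"
proof (induction k)
  case 0
  \<comment> \<open>The zeroth power is the identity of size \<open>dim_row\<close>, so this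
    dimension must be known.\<close>
  have "dim_row (mat_diag n d) = n" by (simp add: mat_diag_def)
  then show ?case by simp
next
  case (Suc k)
  then show ?case by (simp add: mult.commute)
qed

lemma mat_powi_Omega_of_nat: "mat_powi (Omega n) (int m) = mat_diag n (\<lambda>j. (omega n ^ j) ^ m)"
  by (simp add: mat_powi_def Omega_def mat_diag_pow)

lemma mat_powi_Omega_neg:
  "mat_powi (Omega n) (- int m) = mat_diag n (\<lambda>j. (1 / omega n ^ j) ^ m)"
proof (cases "m = 0")
  \<comment> \<open>Here \<open>- int m\<close> is 0 and falls into the nonnegative branch of
    \<open>mat_powi\<close>, where no inverse is taken.\<close>
  case True
  then show ?thesis using mat_powi_Omega_of_nat[of n 0] by simp
next
  case False
  then show ?thesis by (simp add: mat_powi_def Omega_inverse mat_diag_pow)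
qed

text \<open>Reduction of the exponent modulo \<open>n\<close> is harmless because
  \<open>omega n ^ n = 1\<close>.\<close>

lemma omega_pow_circ_index:
  assumes "j < n" "k < n"
  shows "omega n ^ nat ((int k - int j) mod int n) = omega n ^ k / omega n ^ j"
proof (cases "j \<le> k")
  case True
  then have "nat ((int k - int j) mod int n) = k - j"
    using assms by (simp add: nat_diff_distrib)
  then show ?thesis using True by (simp add: power_diff)
next
  case False
  \<comment> \<open>For k < j, adding \<open>n\<close> once brings the difference into the range
    from 0 to n - 1.\<close>
  have "(int k - int j) mod int n = (int k - int j + int n) mod int n" by simp
  also have "\<dots> = int k - int j + int n"
    using False assms by (intro mod_pos_pos_trivial) auto
  finally have "nat ((int k - int j) mod int n) = n + k - j" by simp
  moreover have "omega n ^ (n + k - j) = omega n ^ (n + k) / omega n ^ j"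
    using assms by (intro power_diff) auto
  ultimately show ?thesis using assms by (simp add: power_add omega_pow_n)
qed

lemma circ_fun_carrier [simp]: "circ_fun n f x \<in> carrier_mat n n"
  and dim_row_circ_fun [simp]: "dim_row (circ_fun n f x) = n"
  and dim_col_circ_fun [simp]: "dim_col (circ_fun n f x) = n"
  by (simp_all add: circ_fun_def circ_def)

text \<open>The explicit component formula, read entrywise, is the spectral form: Fourier matrix
  times the diagonal of the \<open>f (omega n ^ s * x)\<close> times the inverse Fourier
  matrix.\<close>

lemma circ_fun_index:
  assumes "j < n" "k < n"
  shows "circ_fun n f x $$ (j, k) =
    1 / of_nat n * (\<Sum>s<n. (omega n ^ j / omega n ^ k) ^ s * f (omega n ^ s * x))"
proof -
  define l where "l = nat ((int k - int j) mod int n)"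
  have "l < n" using assms by (simp add: l_def nat_less_iff)
  moreover have "omega n ^ l = omega n ^ k / omega n ^ j"
    unfolding l_def using assms by (rule omega_pow_circ_index)
  ultimately show ?thesis
    using assms unfolding circ_fun_def circ_def l_def[symmetric]
    by (simp add: fcomponent_explicit omega_powi flip: l_def del: of_nat_mult)
qed

lemma fcomponent_of_type:
  assumes "j < n"
  shows "of_type n j (fcomponent n f j)"
proof -
  have "fcomponent n f j = explicit_component n f j"
    using assms by (auto simp: fun_eq_iff fcomponent_explicit explicit_component_def)
  then show ?thesis
    using explicit_component_decomposition[of n f] assms by (simp add: is_decomposition_def)
qed

lemma Omega_conj_circ_fun:
  "mat_powi (Omega n) (- int m) * circ_fun n f y * mat_powi (Omega n) (int m) =
    circ_fun n f (omega n ^ m * y)" (is "?L = ?R")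
proof -
  let ?A = "mat_diag n (\<lambda>j. (1 / omega n ^ j) ^ m)"
  have "?A * circ_fun n f y \<in> carrier_mat n n"
    by (rule mult_carrier_mat[OF _ circ_fun_carrier]) simp
  then have L: "?L = mat n n (\<lambda>(j, k). (?A * circ_fun n f y) $$ (j, k) * (omega n ^ k) ^ m)"
    unfolding mat_powi_Omega_of_nat mat_powi_Omega_neg by (rule mat_diag_mult_right)
  show ?thesis
  proof (rule eq_matI)
    fix j k assume "j < dim_row ?R" "k < dim_col ?R"
    then have jk: "j < n" "k < n" by auto
    define l where "l = nat ((int k - int j) mod int n)"
    have l: "l < n" using jk by (simp add: l_def nat_less_iff)
    have F: "circ_fun n f z $$ (j, k) = fcomponent n f l z" for z
      using jk by (simp add: circ_fun_def circ_def l_def)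
    \<comment> \<open>The two diagonal factors combine to \<open>(omega n ^ l) ^ m\<close>, which
      the type of component \<open>l\<close> moves into the argument.\<close>
    have "?L $$ (j, k) = (1 / omega n ^ j) ^ m * fcomponent n f l y * (omega n ^ k) ^ m"
      using jk by (simp add: L mat_diag_mult_left[OF circ_fun_carrier] F)
    also have "\<dots> = (omega n ^ l) ^ m * fcomponent n f l y"
      using jk by (simp add: l_def omega_pow_circ_index power_divide)
    also have "\<dots> = fcomponent n f l (omega n ^ m * y)"
      using of_type_pow[OF fcomponent_of_type[OF l]] by simp
    finally show "?L $$ (j, k) = ?R $$ (j, k)" by (simp add: F)
  qed (auto simp: L)
qed

lemma circ_fun_mult:
  assumes "exponential f"
  shows "circ_fun n f z * circ_fun n f x = circ_fun n f (z + x)" (is "?L = ?R")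
proof (rule eq_matI)
  fix j k assume "j < dim_row ?R" "k < dim_col ?R"
  then have jk: "j < n" "k < n" by auto
  let ?w = "omega n"
  \<comment> \<open>\<open>u\<close> and \<open>v\<close> absorb everything independent of the inner
    index \<open>l\<close> of the matrix product, which then occurs only in powers of
    \<open>omega n\<close>.\<close>
  define u where "u s = ?w ^ (j * s) * f (?w ^ s * z)" for s
  define v where "v t = f (?w ^ t * x) / ?w ^ (k * t)" for t
  have Fz: "circ_fun n f z $$ (j, l) = 1 / of_nat n * (\<Sum>s<n. u s / ?w ^ (l * s))" if "l < n" for l
    using that jk by (simp add: circ_fun_index u_def power_divide power_mult)
  have Fx: "circ_fun n f x $$ (l, k) = 1 / of_nat n * (\<Sum>t<n. ?w ^ (l * t) * v t)" if "l < n" for l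
    using that jk by (simp add: circ_fun_index v_def power_divide power_mult)
  have "?L $$ (j, k) = (\<Sum>l<n. circ_fun n f z $$ (j, l) * circ_fun n f x $$ (l, k))"
    using jk by (simp add: scalar_prod_def atLeast0LessThan)
  also have "\<dots> = (\<Sum>l<n. 1 / (of_nat n)\<^sup>2 *
      (\<Sum>s<n. \<Sum>t<n. (u s / ?w ^ (l * s)) * (?w ^ (l * t) * v t)))"
    by (intro sum.cong refl) (simp only: Fz Fx lessThan_iff power2_eq_square sum_product[symmetric], simp)
  also have "\<dots> = 1 / (of_nat n)\<^sup>2 *
      (\<Sum>l<n. \<Sum>s<n. \<Sum>t<n. u s * v t * (?w ^ t / ?w ^ s) ^ l)"
    by (simp add: sum_distrib_left power_divide mult_ac flip: power_mult)
  also have "(\<Sum>l<n. \<Sum>s<n. \<Sum>t<n. u s * v t * (?w ^ t / ?w ^ s) ^ l) =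
      (\<Sum>s<n. \<Sum>t<n. u s * v t * (\<Sum>l<n. (?w ^ t / ?w ^ s) ^ l))"
    by (subst sum.swap, rule sum.cong[OF refl], subst sum.swap) (simp add: sum_distrib_left)
  \<comment> \<open>Orthogonality of the characters removes all mixed terms, so only equal
    eigenvalue indices are multiplied.\<close>
  also have "\<dots> = (\<Sum>s<n. \<Sum>t<n. if t = s then of_nat n * (u s * v s) else 0)"
    by (intro sum.cong refl) (auto simp: omega_orthogonality)
  also have "\<dots> = of_nat n * (\<Sum>s<n. u s * v s)"
    by (simp add: sum_distrib_left)
  also have "1 / (of_nat n)\<^sup>2 * \<dots> = 1 / of_nat n * (\<Sum>s<n. u s * v s)"
    by (simp add: power2_eq_square)
  also have "\<dots> = ?R $$ (j, k)"
  proof -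
    \<comment> \<open>Applied with \<open>a = omega n ^ s\<close>: the eigenvalues multiply.\<close>
    have "f (a * (z + x)) = f (a * z) * f (a * x)" for a
      using assms by (simp add: exponential_def distrib_left)
    then show ?thesis
      using jk by (simp add: circ_fun_index u_def v_def power_divide mult.assoc flip: power_mult)
  qed
  finally show "?L $$ (j, k) = ?R $$ (j, k)" .
qed auto

theorem theorem2p9:
  fixes n m :: nat and f :: "complex \<Rightarrow> complex" and x y :: complex
  assumes "n \<ge> 2"
    and "exponential f"
    and "m \<in> {0..n - 1}"
  shows "circ_fun n f (x + omega n ^ m * y) =
    mat_powi (Omega n) (- int m) * circ_fun n f y * mat_powi (Omega n) (int m) * circ_fun n f x"
  \<comment> \<open>The conjugated factor stands on the left, so the product is \<open>F\<close> at
    the sum in swapped order; hence \<open>add.commute\<close>.\<close>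
  by (simp only: Omega_conj_circ_fun circ_fun_mult[OF assms(2)] add.commute)

end
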